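(* For every monic $g\in\mathbb{F}_2[x]$ of degree $m$ and every $A\in\mathbb{F}_2[x]$ with $\deg A<2m$, the Frobenius-factorized reduction algorithm (described in the context), applied to $g$ and $A$, returns $A\bmod g$.
   Context: Here $m\ge1$. Write $g(x)=x^m+\sum_{t\in T}x^t$ with $T\subseteq\{0,\ldots,m-1\}$, and put $\Delta_t=m-t$ for $t\in T$. Polynomials of degree below $m$ are identified with coefficient vectors in $\mathbb{F}_2^m$. For $d\ge 0$, $N^d$ is the truncated right shift: $(N^dy)_i=y_{i+d}$ if $0\le i<m-d$ and $(N^dy)_i=0$ if $m-d\le i<m$; $N^d=0$ for $d\ge m$. For $\deg Y<m$ let $V(Y)=\sum_{t\in T}(x^tY\bmod x^m)$. Empty sums are zero. If $T\subseteq\{0\}$ set $r=0$; otherwise set $\Delta_{\min}=\min\{\Delta_t:t\in T\}$ and $r=\lceil\log_2(m/\Delta_{\min})\rceil$. For $k\ge 0$ let $T_k=\{t\in T:2^k\Delta_t<m\}$. Frobenius-factorized reduction algorithm: split $A=L+x^mH$ with $\deg L,\deg H<m$ and set $Y\leftarrow H$. For $k=0,\ldots,r-1$ in order, read one immutable stage input $Y_{\mathrm{old}}$ (the current value of $Y$), compute synchronously $$Y_{\mathrm{new}}=Y_{\mathrm{old}}+\sum_{t\in T_k}N^{2^k\Delta_t}Y_{\mathrm{old}},$$ and set $Y\leftarrow Y_{\mathrm{new}}$. Finally return $L+V(Y)$. $A\bmod g$ is the unique remainder of degree below $m$ on division of $A$ by $g$. *)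

theory Defs
  imports Complex_Main "HOL-Library.Z2" "HOL-Computational_Algebra.Polynomial"
begin

text \<open>The field with two elements is the type \<^typ>\<open>bit\<close>. A vector of length \<open>m\<close> over it is
  represented by the polynomial of degree below \<open>m\<close> with these coefficients.\<close>

definition taps :: "bit poly \<Rightarrow> nat set" where
  "taps g = {t. t < degree g \<and> coeff g t = 1}"

lemma monic_eq_sum_taps:
  assumes "lead_coeff g = 1"
  shows "g = monom 1 (degree g) + (\<Sum>t\<in>taps g. monom 1 t)"
proof (rule poly_eqI)
  fix n
  have fin: "finite (taps g)"
    unfolding taps_def by simp
  have "coeff (\<Sum>t\<in>taps g. monom 1 t) n = (if n \<in> taps g then 1 else 0)"
    using fin by (simp add: coeff_sum)
  then show "coeff g n = coeff (monom 1 (degree g) + (\<Sum>t\<in>taps g. monom 1 t)) n"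
    using assms coeff_eq_0[of g n] bit_not_one_iff[of "coeff g n"]
    by (cases n "degree g" rule: linorder_cases) (auto simp: taps_def)
qed

definition gap :: "nat \<Rightarrow> nat \<Rightarrow> nat" where
  "gap m t = m - t"

text \<open>The truncated right shift \<open>N\<^sup>d\<close> on vectors of length \<open>m\<close>. For \<open>d \<ge> m\<close> the natural number
  \<open>m - d\<close> is zero, hence so is the result.\<close>

definition trunc_shift :: "nat \<Rightarrow> nat \<Rightarrow> bit poly \<Rightarrow> bit poly" where
  "trunc_shift m d y = (\<Sum>i<m - d. monom (coeff y (i + d)) i)"

lemma coeff_trunc_shift:
  "coeff (trunc_shift m d y) i = (if i < m - d then coeff y (i + d) else 0)"
  by (simp add: trunc_shift_def coeff_sum)

definition low_fold :: "nat \<Rightarrow> nat set \<Rightarrow> bit poly \<Rightarrow> bit poly" where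
  "low_fold m T Y = (\<Sum>t\<in>T. (monom 1 t * Y) mod monom 1 m)"

definition num_stages :: "nat \<Rightarrow> nat set \<Rightarrow> nat" where
  "num_stages m T =
    (if T \<subseteq> {0} then 0 else nat \<lceil>log 2 (real m / real (Min (gap m ` T)))\<rceil>)"

definition active_taps :: "nat \<Rightarrow> nat set \<Rightarrow> nat \<Rightarrow> nat set" where
  "active_taps m T k = {t \<in> T. 2 ^ k * gap m t < m}"

definition stage :: "nat \<Rightarrow> nat set \<Rightarrow> nat \<Rightarrow> bit poly \<Rightarrow> bit poly" where
  "stage m T k Y = Y + (\<Sum>t\<in>active_taps m T k. trunc_shift m (2 ^ k * gap m t) Y)"

text \<open>Division with remainder by the monomial of degree \<open>m\<close> splits \<open>A\<close> into its low part \<open>L\<close> and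
  its high part \<open>H\<close>. The stages run in increasing order of \<open>k\<close>.\<close>

definition frobenius_reduction :: "bit poly \<Rightarrow> bit poly \<Rightarrow> bit poly" where
  "frobenius_reduction g A =
    (let m = degree g;
         T = taps g;
         L = A mod monom 1 m;
         H = A div monom 1 m;
         Y = fold (stage m T) [0..<num_stages m T] H
     in L + low_fold m T Y)"

end

theory Submission imports Defs begin

text \<open>
  Let \<open>N\<close> be the shift by one coefficient and \<open>U = (\<Sum>t\<in>T. N ^ (m - t))\<close>. In characteristic two,
  \<open>U ^ 2 ^ k = (\<Sum>t\<in>T. N ^ (2 ^ k * (m - t)))\<close>, so stage \<open>k\<close> multiplies by \<open>1 + U ^ 2 ^ k\<close>.
  By telescoping, the value \<open>Y\<close> after \<open>k\<close> stages satisfies \<open>(1 + U) Y = (1 + U ^ 2 ^ k) H\<close>,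
  and \<open>U ^ 2 ^ r = 0\<close>. Since \<open>g Y = x\<^sup>m (1 + U) Y + V Y\<close>, the final \<open>Y\<close> gives
  \<open>A = g Y + (L + V Y)\<close>, where \<open>L + V Y\<close> has degree below \<open>m\<close>.
\<close>

lemma bit_poly_add_self [simp]: "p + p = 0" for p :: "bit poly"
proof (rule poly_eqI)
  show "coeff (p + p) n = coeff 0 n" for n
    unfolding coeff_add coeff_0 by (cases "coeff p n") simp_all
qed

lemma bit_poly_add_left_self [simp]: "p + (p + q) = q" for p q :: "bit poly"
  by (simp flip: add.assoc)

lemma poly_shift_add: "poly_shift d (p + q) = poly_shift d p + poly_shift d q"
  for p q :: "'a::comm_monoid_add poly"
  by (rule poly_eqI) (simp add: coeff_poly_shift)

lemma poly_shift_sum: "poly_shift d (\<Sum>i\<in>I. f i) = (\<Sum>i\<in>I. poly_shift d (f i))"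
  for f :: "'i \<Rightarrow> 'a::comm_monoid_add poly"
  by (induction I rule: infinite_finite_induct) (simp_all add: poly_shift_add)

lemma poly_shift_poly_shift: "poly_shift d (poly_shift e p) = poly_shift (d + e) p"
  by (rule poly_eqI) (simp add: coeff_poly_shift ac_simps)

lemma poly_shift_eq_0: "degree p < d \<Longrightarrow> poly_shift d p = 0"
  by (rule poly_eqI) (simp add: coeff_poly_shift coeff_eq_0)

lemma div_monom_eq_poly_shift: "p div monom 1 d = poly_shift d p" for p :: "'a::field poly"
proof -
  have "p = poly_shift d p * monom 1 d + poly_cutoff d p"
    by (rule poly_eqI)
      (simp add: mult.commute[of _ "monom 1 d"] coeff_monom_mult coeff_poly_shift coeff_poly_cutoff)
  then have "p div monom 1 d = poly_shift d p + poly_cutoff d p div monom 1 d"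
    by (metis div_mult_self3 add.commute monom_eq_0_iff one_neq_zero)
  moreover have "poly_cutoff d p div monom 1 d = 0"
  \<comment> \<open>The zero case is separate because for \<open>d = 0\<close> the bound
    \<open>degree (poly_cutoff d p) < d\<close> fails.\<close>
  proof (cases "poly_cutoff d p = 0")
    case False
    then have "degree (poly_cutoff d p) < d"
      by (metis coeff_poly_cutoff leading_coeff_0_iff)
    then show ?thesis
      by (simp add: div_poly_less degree_monom_eq)
  qed simp
  ultimately show ?thesis by simp
qed

lemma poly_shift_monom_mult:
  assumes "t \<le> d"
  shows "poly_shift d (monom 1 t * p) = poly_shift (d - t) (p :: 'a::comm_semiring_1 poly)"
  using assms by (intro poly_eqI) (simp add: coeff_poly_shift coeff_monom_mult)

lemma degree_poly_shift_le: "degree (poly_shift d p) \<le> degree p"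
  by (rule degree_le) (simp add: coeff_poly_shift coeff_eq_0)

text \<open>Truncation only discards coefficients of index at least \<open>m\<close>, which vanish
  here. Untruncated shifts compose by adding exponents.\<close>

lemma trunc_shift_eq_poly_shift:
  "degree y < m \<Longrightarrow> trunc_shift m d y = poly_shift d y"
  by (rule poly_eqI) (auto simp: coeff_trunc_shift coeff_poly_shift coeff_eq_0)

text \<open>Separating the index set from the exponents lets \<open>U\<close> and all its powers
  \<open>U ^ 2 ^ k\<close> be sums over the same taps.\<close>

definition shift_sum :: "'i set \<Rightarrow> ('i \<Rightarrow> nat) \<Rightarrow> bit poly \<Rightarrow> bit poly" where
  "shift_sum I d y = (\<Sum>i\<in>I. poly_shift (d i) y)"

lemma shift_sum_add: "shift_sum I d (p + q) = shift_sum I d p + shift_sum I d q"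
  by (simp add: shift_sum_def poly_shift_add sum.distrib)

lemma shift_sum_commute:
  "shift_sum I d (shift_sum J e y) = shift_sum J e (shift_sum I d y)"
  by (simp add: shift_sum_def poly_shift_sum poly_shift_poly_shift add.commute)
    (rule sum.swap)

lemma degree_shift_sum_less:
  assumes "degree y < m"
  shows "degree (shift_sum I d y) < m"
  unfolding shift_sum_def using assms
  by (intro degree_sum_less) (auto intro: le_less_trans[OF degree_poly_shift_le])

text \<open>This is the Frobenius identity for commuting shifts: each mixed product occurs twice and
  cancels in characteristic two.\<close>

lemma shift_sum_square:
  assumes "finite I"
  shows "shift_sum I d (shift_sum I d y) = shift_sum I (\<lambda>i. 2 * d i) y"
  using assms
proof (induction I rule: finite_induct)
  case empty
  show ?case by (simp add: shift_sum_def)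
next
  case (insert a I)
  have split: "shift_sum (insert a I) e z = poly_shift (e a) z + shift_sum I e z" for e z
    using insert.hyps by (simp add: shift_sum_def)
  have cross: "shift_sum I d (poly_shift (d a) y) = poly_shift (d a) (shift_sum I d y)"
    by (simp add: shift_sum_def poly_shift_sum poly_shift_poly_shift add.commute)
  show ?case
    by (simp add: split shift_sum_add poly_shift_add poly_shift_poly_shift cross insert.IH
        add.assoc mult_2)
qed

text \<open>Restricting to active taps loses nothing: every other tap shifts by at least
  \<open>m\<close> and so annihilates \<open>y\<close>.\<close>

lemma stage_eq_shift_sum:
  assumes "finite T" and "degree y < m"
  shows "stage m T k y = y + shift_sum T (\<lambda>t. 2 ^ k * gap m t) y"
proof -
  have "(\<Sum>t\<in>active_taps m T k. trunc_shift m (2 ^ k * gap m t) y)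
      = (\<Sum>t\<in>T. poly_shift (2 ^ k * gap m t) y)"
    using assms
    by (intro sum.mono_neutral_cong_left)
      (auto simp: active_taps_def trunc_shift_eq_poly_shift intro: poly_shift_eq_0)
  then show ?thesis
    by (simp add: stage_def shift_sum_def)
qed

text \<open>The degree bound is carried through the induction because rewriting a stage as a
  \<open>shift_sum\<close> requires it of the current value.\<close>

lemma stages_telescope:
  assumes "finite T" and "degree h < m"
  defines "u \<equiv> \<lambda>k. shift_sum T (\<lambda>t. 2 ^ k * gap m t)"
    and "y \<equiv> \<lambda>k. fold (stage m T) [0..<k] h"
  shows "degree (y k) < m \<and> y k + u 0 (y k) = h + u k h"
proof (induction k)
  case 0
  show ?case using assms(2) by (simp add: y_def)
next
  case (Suc k)
  have step: "y (Suc k) = y k + u k (y k)"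
    using Suc.IH assms(1) by (simp add: y_def u_def stage_eq_shift_sum)
  have add: "u j (p + q) = u j p + u j q" for j p q
    by (simp add: u_def shift_sum_add)
  have commute: "u 0 (u k z) = u k (u 0 z)" for z
    unfolding u_def by (rule shift_sum_commute)
  have "y (Suc k) + u 0 (y (Suc k)) = (y k + u 0 (y k)) + u k (y k + u 0 (y k))"
    unfolding step add
    by (simp only: commute ac_simps)
  \<comment> \<open>By the induction hypothesis this is \<open>1 + u k\<close> applied twice to
    \<open>h\<close>; the two copies of \<open>u k h\<close> cancel.\<close>
  also have "\<dots> = h + u k (u k h)"
    using Suc.IH by (simp add: add add.assoc)
  also have "u k (u k h) = u (Suc k) h"
    using assms(1) by (simp add: u_def shift_sum_square mult.assoc)
  finally show ?case
    using Suc.IH by (simp add: step u_def degree_add_less degree_shift_sum_less)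
qed

lemma le_power_num_stages:
  assumes "T \<subseteq> {..<m}" and "t \<in> T"
  shows "m \<le> 2 ^ num_stages m T * gap m t"
proof (cases "T \<subseteq> {0}")
  \<comment> \<open>Here \<open>t = 0\<close> has gap \<open>m\<close>, so zero stages already
    suffice.\<close>
  case True
  with assms(2) show ?thesis
    by (auto simp: num_stages_def gap_def)
next
  case False
  define \<delta> where "\<delta> = Min (gap m ` T)"
  have fin: "finite (gap m ` T)"
    using assms(1) finite_subset by blast
  have le: "\<delta> \<le> gap m t"
    unfolding \<delta>_def using fin assms(2) by simp
  have "\<delta> \<in> gap m ` T"
    unfolding \<delta>_def using fin assms(2) by (intro Min_in) auto
  then have pos: "\<delta> > 0"
    using assms(1) by (auto simp: gap_def)
  have "m > 0"
    using assms by auto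
  have "log 2 (real m / real \<delta>) \<le> real (num_stages m T)"
    using False by (simp add: num_stages_def \<delta>_def real_nat_ceiling_ge)
  then have "real m / real \<delta> \<le> 2 ^ num_stages m T"
    using pos \<open>m > 0\<close> by (simp add: log_le_iff powr_realpow)
  then have "real m \<le> real (2 ^ num_stages m T * \<delta>)"
    using pos by (simp add: field_simps)
  then have "m \<le> 2 ^ num_stages m T * \<delta>"
    by (simp only: of_nat_le_iff)
  also have "\<dots> \<le> 2 ^ num_stages m T * gap m t"
    using le by simp
  finally show ?thesis .
qed

text \<open>After \<open>num_stages m T\<close> doublings every shift is at least \<open>m\<close>,
  so the error term of the telescoping identity vanishes and the stages invert
  \<open>1 + U\<close>.\<close>

lemma stages_inverse:
  assumes "T \<subseteq> {..<m}" and "degree h < m"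
  defines "y \<equiv> fold (stage m T) [0..<num_stages m T] h"
  shows "y + shift_sum T (gap m) y = h"
proof -
  have "shift_sum T (\<lambda>t. 2 ^ num_stages m T * gap m t) h = 0"
    unfolding shift_sum_def using assms(2) le_power_num_stages[OF assms(1)]
    by (intro sum.neutral ballI poly_shift_eq_0) (meson less_le_trans)
  moreover have "finite T"
    using assms(1) finite_subset by blast
  ultimately show ?thesis
    using stages_telescope[of T h m "num_stages m T"] assms(2) by (simp add: y_def)
qed

text \<open>Divide each \<open>monom 1 t * y\<close> by \<open>monom 1 m\<close>: the quotient is
  the shift by \<open>m - t\<close>, and the remainders make up \<open>low_fold\<close>.\<close>

lemma sum_monom_mult_eq_shift_sum_low_fold:
  assumes "T \<subseteq> {..<m}"
  shows "(\<Sum>t\<in>T. monom 1 t) * y = monom 1 m * shift_sum T (gap m) y + low_fold m T y"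
proof -
  have "monom 1 t * y = monom 1 m * poly_shift (gap m t) y + (monom 1 t * y) mod monom 1 m"
    if "t \<in> T" for t
  proof -
    have "t \<le> m"
      using that assms by auto
    then have "poly_shift (gap m t) y = (monom 1 t * y) div monom 1 m"
      by (simp add: div_monom_eq_poly_shift poly_shift_monom_mult gap_def)
    then show ?thesis by simp
  qed
  then show ?thesis
    by (simp add: shift_sum_def low_fold_def sum_distrib_left sum_distrib_right
        cong: sum.cong flip: sum.distrib)
qed

lemma degree_mod_monom_less:
  "m > 0 \<Longrightarrow> degree (p mod monom 1 m) < m" for p :: "'a::field poly"
  using degree_mod_less'[of "monom 1 m" p]
  by (cases "p mod monom 1 m = 0") (auto simp: degree_monom_eq)

theorem theorem4p1:
  fixes m :: nat and g A :: "bit poly"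
  assumes "m \<ge> 1"
    and "lead_coeff g = 1" and "degree g = m"
    and "degree A < 2 * m"
  shows "frobenius_reduction g A = A mod g"
proof -
  define T where "T = taps g"
  define L where "L = A mod monom 1 m"
  define H where "H = A div monom 1 m"
  define Y where "Y = fold (stage m T) [0..<num_stages m T] H"
  have T: "T \<subseteq> {..<m}"
    using assms(3) by (auto simp: T_def taps_def)
  have "degree H < m"
    unfolding H_def div_monom_eq_poly_shift using assms(1,4)
    \<comment> \<open>A coefficient of \<open>H\<close> of index at least \<open>m\<close> is one of
      \<open>A\<close> of index at least \<open>2 * m\<close>.\<close>
    by (intro degree_lessI) (auto simp: coeff_poly_shift coeff_eq_0)
  then have H: "Y + shift_sum T (gap m) Y = H"
    unfolding Y_def using T by (rule stages_inverse[rotated])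
  have "g = monom 1 m + (\<Sum>t\<in>T. monom 1 t)"
    unfolding T_def using monic_eq_sum_taps[OF assms(2)] assms(3) by simp
  then have "g * Y = monom 1 m * Y + (\<Sum>t\<in>T. monom 1 t) * Y"
    by (simp add: distrib_right)
  also have "\<dots> = monom 1 m * (Y + shift_sum T (gap m) Y) + low_fold m T Y"
    by (simp add: sum_monom_mult_eq_shift_sum_low_fold[OF T] distrib_left add.assoc)
  finally have "g * Y = monom 1 m * H + low_fold m T Y"
    unfolding H .
  \<comment> \<open>Adding the claimed remainder doubles \<open>low_fold m T Y\<close>, which
    cancels and leaves the division of \<open>A\<close> by \<open>monom 1 m\<close>.\<close>
  then have "g * Y + (L + low_fold m T Y)
      = monom 1 m * H + L + (low_fold m T Y + low_fold m T Y)"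
    by (simp only: ac_simps)
  then have A: "A = Y * g + (L + low_fold m T Y)"
    by (simp add: H_def L_def mult.commute)
  have "degree (low_fold m T Y) < m"
    unfolding low_fold_def using assms(1)
    by (intro degree_sum_less) (auto simp: degree_mod_monom_less)
  then have "degree (L + low_fold m T Y) < degree g"
    using assms(1,3) by (simp add: L_def degree_add_less degree_mod_monom_less)
  then have "A mod g = L + low_fold m T Y"
    by (subst A) (simp add: mod_poly_less)
  then show ?thesis
    using assms(3) by (simp add: frobenius_reduction_def T_def L_def H_def Y_def Let_def)
qed

end
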